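(* Let $X\in\mathcal{L}\cap\mathbb{R}(r)$ with $\mathrm{rank}(X)=s$, with a fixed singular value decomposition $X=U\Sigma(X)V^\top$, and let $\mathbb{R}_X(r)$ be the set associated with $(X,U,V)$. (i) If $s=r$ and Assumption 1 holds at $X$ (i.e. the matrices $T_X^1,\dots,T_X^l$ are linearly independent), then $$\mathrm{N}^F_{\mathcal{L}\cap\mathbb{R}(r)}(X)=\mathrm{N}_{\mathcal{L}}(X)+\mathrm{N}^F_{\mathbb{R}(r)}(X).$$ (ii) If $s<r$ and Assumption 2 holds at $X$ (i.e. the matrices $R_X^1,\dots,R_X^l$ are linearly independent), then $$\mathrm{N}^F_{\mathcal{L}\cap\mathbb{R}(r)}(X)\subseteq \mathrm{N}^F_{\mathcal{L}\cap\mathbb{R}_X(r)}(X)=\mathrm{N}_{\mathcal{L}}(X)+\mathrm{N}^F_{\mathbb{R}_X(r)}(X).$$ If, in addition, $\mathrm{N}^F_{\mathbb{R}_X(r)}(X)\subseteq \mathrm{T}_{\mathcal{L}}(X)$ (this is true in the case of $s\le r-2$ and $m=n$), then $$\mathrm{N}^F_{\mathcal{L}\cap\mathbb{R}(r)}(X)=\mathrm{N}_{\mathcal{L}}(X)+\mathrm{N}^F_{\mathbb{R}(r)}(X)=\mathrm{N}_{\mathcal{L}}(X).$$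
   Context: Let $m\ge n$ and $1\le r<n$ be integers. $\mathbb{R}^{m\times n}$ carries the inner product $\langle X,Y\rangle=\sum_{ij}X_{ij}Y_{ij}$ and Frobenius norm $\|\cdot\|_F$. Given $A^1,\dots,A^l\in\mathbb{R}^{m\times n}$ and $b_1,\dots,b_l\in\mathbb{R}$, set $\mathcal{L}=\{X\in\mathbb{R}^{m\times n}:\langle A^i,X\rangle=b_i,\ i=1,\dots,l\}$ and $\mathbb{R}(r)=\{X\in\mathbb{R}^{m\times n}:\mathrm{rank}(X)\le r\}$. Cones. The polar of a cone $\mathcal{K}$ is $\mathcal{K}^\circ=\{Y:\langle Y,X\rangle\le 0\ \forall X\in\mathcal{K}\}$. For a nonempty closed set $\Omega\subseteq\mathbb{R}^{m\times n}$ and $X\in\Omega$, the Bouligand tangent cone $\mathrm{T}^B_\Omega(X)$ is the set of all $\Xi$ for which there are $X^k\in\Omega$ with $X^k\to X$ and $t_k>0$ with $t_k\to0$ such that $t_k^{-1}(X^k-X)\to\Xi$; the Fréchet normal cone is $\mathrm{N}^F_\Omega(X)=[\mathrm{T}^B_\Omega(X)]^\circ$. For the affine set $\mathcal{L}$ one writes simply $\mathrm{T}_{\mathcal{L}}(X)=\mathrm{T}^B_{\mathcal{L}}(X)$ and $\mathrm{N}_{\mathcal{L}}(X)=\mathrm{N}^F_{\mathcal{L}}(X)$. SVD and the set $\mathbb{R}_X(r)$. For $X\in\mathbb{R}^{m\times n}$ of rank $s$ fix an SVD $X=U\Sigma(X)V^\top$, with $U\in\mathbb{R}^{m\times m}$,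 $V\in\mathbb{R}^{n\times n}$ orthogonal and $\Sigma(X)$ the (rectangular) diagonal $m\times n$ matrix of singular values; $\Gamma\subseteq\{1,\dots,n\}$, $|\Gamma|=s$, is the index set of the nonzero singular values, $\Gamma_m^\perp=\{1,\dots,m\}\setminus\Gamma$, $\Gamma_n^\perp=\{1,\dots,n\}\setminus\Gamma$. For an index set $J$, $U_J$ (resp. $V_J$) is the submatrix of columns of $U$ (resp. $V$) indexed by $J$. Let $\mathcal{J}=\{J\subseteq\{1,\dots,n\}:|J|=r,\ \Gamma\subseteq J\}$, $\mathbb{R}_X(J)=\{U_JAV_J^\top:A\in\mathbb{R}^{r\times r}\}$ for $J\in\mathcal{J}$, and $\mathbb{R}_X(r)=\bigcup_{J\in\mathcal{J}}\mathbb{R}_X(J)$ (these depend on the chosen $U,V$). For $i=1,\dots,l$ define the block matrices $$T^i_X=\begin{bmatrix}U_\Gamma^\top A^iV_\Gamma & U_\Gamma^\top A^iV_{\Gamma_n^\perp}\\ U_{\Gamma_m^\perp}^\top A^iV_\Gamma & 0\end{bmatrix},\qquad R^i_X=\begin{bmatrix}U_\Gamma^\top A^iV_\Gamma & 0\\ 0&0\end{bmatrix}.$$ *)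

theory Defs
  imports "HOL-Analysis.Analysis"
begin

text \<open>
  An \<open>m \<times> n\<close> real matrix is an element of \<^typ>\<open>real^'n^'m\<close>; the library inner product and norm of
  this type are the trace inner product and the Frobenius norm. The inclusion of the column indices
  \<open>{1..n}\<close> into the row indices \<open>{1..m}\<close> (available because \<open>n \<le> m\<close>) is represented by an
  injection \<open>e :: 'n \<Rightarrow> 'm\<close>, so that a set \<open>J\<close> of column indices of \<open>V\<close> corresponds to the set
  \<open>e ` J\<close> of column indices of \<open>U\<close>.
\<close>

definition polar :: "'a::real_inner set \<Rightarrow> 'a set" where
  "polar K = {Y. \<forall>X\<in>K. Y \<bullet> X \<le> 0}"

definition bouligand_tangent :: "'a::real_normed_vector set \<Rightarrow> 'a \<Rightarrow> 'a set" where
  "bouligand_tangent \<Omega> X =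
     {\<Xi>. \<exists>Xs t. (\<forall>k::nat. Xs k \<in> \<Omega>) \<and> Xs \<longlonglongrightarrow> X \<and> (\<forall>k. 0 < (t k :: real)) \<and> t \<longlonglongrightarrow> 0 \<and>
              (\<lambda>k. inverse (t k) *\<^sub>R (Xs k - X)) \<longlonglongrightarrow> \<Xi>}"

definition frechet_normal :: "'a::real_inner set \<Rightarrow> 'a \<Rightarrow> 'a set" where
  "frechet_normal \<Omega> X = polar (bouligand_tangent \<Omega> X)"

definition affine_constraints ::
    "nat \<Rightarrow> (nat \<Rightarrow> real^'n^'m) \<Rightarrow> (nat \<Rightarrow> real) \<Rightarrow> (real^'n^'m) set" where
  "affine_constraints l A b = {X. \<forall>i\<in>{1..l}. A i \<bullet> X = b i}"

definition rank_le :: "nat \<Rightarrow> (real^'n^'m) set" where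
  "rank_le r = {X. rank X \<le> r}"

definition rect_diag :: "('n \<Rightarrow> 'm) \<Rightarrow> real^'n \<Rightarrow> real^'n^'m" where
  "rect_diag e \<sigma> = (\<chi> i j. if i = e j then \<sigma> $ j else 0)"

text \<open>The singular values are not required to be listed in any particular order.\<close>

definition is_svd ::
    "('n \<Rightarrow> 'm) \<Rightarrow> real^'n^'m \<Rightarrow> real^'m^'m \<Rightarrow> real^'n \<Rightarrow> real^'n^'n \<Rightarrow> bool" where
  "is_svd e X U \<sigma> V \<longleftrightarrow>
     orthogonal_matrix U \<and> orthogonal_matrix V \<and> (\<forall>j. 0 \<le> \<sigma> $ j) \<and>
     X = U ** rect_diag e \<sigma> ** transpose V"

definition sv_support :: "real^'n \<Rightarrow> 'n set" where
  "sv_support \<sigma> = {j. \<sigma> $ j \<noteq> 0}"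

text \<open>The matrices \<open>U\<^sub>J B V\<^sub>J\<^sup>T\<close>, with the rows and columns of the square matrix \<open>B\<close> indexed by
  \<open>J\<close> itself and the product written out entrywise.\<close>

definition RX_J ::
    "('n \<Rightarrow> 'm) \<Rightarrow> real^'m^'m \<Rightarrow> real^'n^'n \<Rightarrow> 'n set \<Rightarrow> (real^'n^'m) set" where
  "RX_J e U V J =
     {(\<chi> i j. \<Sum>p\<in>J. \<Sum>q\<in>J. U $ i $ e p * B p q * V $ j $ q) | B :: 'n \<Rightarrow> 'n \<Rightarrow> real. True}"

definition RX ::
    "('n \<Rightarrow> 'm) \<Rightarrow> real^'m^'m \<Rightarrow> real^'n \<Rightarrow> real^'n^'n \<Rightarrow> nat \<Rightarrow> (real^'n^'m) set" where
  "RX e U \<sigma> V r = (\<Union>J\<in>{J. card J = r \<and> sv_support \<sigma> \<subseteq> J}. RX_J e U V J)"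

text \<open>The block matrices \<open>T\<^sub>X\<close> and \<open>R\<^sub>X\<close> built from \<open>U\<^sup>T A V\<close>. The rows and columns keep their
  original positions instead of being permuted so that those indexed by \<open>\<Gamma>\<close> come first; a block is
  thus selected by membership of the row index in \<open>e ` \<Gamma>\<close> and of the column index in \<open>\<Gamma>\<close>.\<close>

definition T_block ::
    "('n \<Rightarrow> 'm) \<Rightarrow> real^'m^'m \<Rightarrow> real^'n \<Rightarrow> real^'n^'n \<Rightarrow> real^'n^'m \<Rightarrow> real^'n^'m" where
  "T_block e U \<sigma> V A =
     (\<chi> i j. if i \<in> e ` sv_support \<sigma> \<or> j \<in> sv_support \<sigma>
            then (transpose U ** A ** V) $ i $ j else 0)"

definition R_block ::
    "('n \<Rightarrow> 'm) \<Rightarrow> real^'m^'m \<Rightarrow> real^'n \<Rightarrow> real^'n^'n \<Rightarrow> real^'n^'m \<Rightarrow> real^'n^'m" where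
  "R_block e U \<sigma> V A =
     (\<chi> i j. if i \<in> e ` sv_support \<sigma> \<and> j \<in> sv_support \<sigma>
            then (transpose U ** A ** V) $ i $ j else 0)"

text \<open>Linear independence of an indexed family; injectivity rules out repeated members, which the
  independence of the set of values alone would not detect.\<close>

definition lin_indep_family :: "('i \<Rightarrow> 'a::real_vector) \<Rightarrow> 'i set \<Rightarrow> bool" where
  "lin_indep_family f I \<longleftrightarrow> inj_on f I \<and> independent (f ` I)"

definition assumption1 ::
    "('n \<Rightarrow> 'm) \<Rightarrow> real^'m^'m \<Rightarrow> real^'n \<Rightarrow> real^'n^'n \<Rightarrow> nat \<Rightarrow> (nat \<Rightarrow> real^'n^'m) \<Rightarrow> bool" where
  "assumption1 e U \<sigma> V l A \<longleftrightarrow> lin_indep_family (\<lambda>i. T_block e U \<sigma> V (A i)) {1..l}"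

definition assumption2 ::
    "('n \<Rightarrow> 'm) \<Rightarrow> real^'m^'m \<Rightarrow> real^'n \<Rightarrow> real^'n^'n \<Rightarrow> nat \<Rightarrow> (nat \<Rightarrow> real^'n^'m) \<Rightarrow> bool" where
  "assumption2 e U \<sigma> V l A \<longleftrightarrow> lin_indep_family (\<lambda>i. R_block e U \<sigma> V (A i)) {1..l}"

end

theory Submission
  imports Defs
begin

text \<open>
  Linear independence of the masked constraint matrices yields directions \<open>\<theta> j\<close>, supported in
  the respective blocks and dual to the \<open>A i\<close>. For a normal \<open>Y\<close> of the intersection, put
  \<open>W = Y - \<Sum>\<^sub>j (Y \<bullet> \<theta> j) A j\<close>. Any direction \<open>Z\<close> can be moved into the linearized constraints
  by subtracting a combination of the \<open>\<theta> j\<close>; whenever the result is tangent (together with its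
  negative), \<open>W\<close> is orthogonal to \<open>Z\<close>. The proof thus reduces to finding enough tangent directions.

  If \<open>s < r\<close>, the corrected directions are tangent along straight lines: the subspaces forming
  \<open>\<real>\<^sub>X(r)\<close> all contain the block \<open>\<Gamma> \<times> \<Gamma>\<close>, which gives the equality for \<open>\<real>\<^sub>X(r)\<close>,
  and changing that block and one further entry leaves at most \<open>s + 1 \<le> r\<close> nonzero rows, which
  even forces \<open>W = 0\<close> for \<open>\<real>(r)\<close>.

  If \<open>s = r\<close>, the tangent vectors of \<open>\<real>(r)\<close> have a vanishing \<open>\<Gamma>\<^sup>\<bottom> \<times> \<Gamma>\<^sup>\<bottom>\<close> block, because null
  vectors of \<open>X\<close> are limits of null vectors of nearby matrices of rank at most \<open>r\<close>. Conversely, such a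
  \<open>w\<close> is the first-order term of a product \<open>(I + G) X (I + H)\<close>, whose rank never exceeds \<open>r\<close>, and
  the quadratic error in the linear constraints is removed by a fixed point argument.
\<close>


section \<open>Tangent and normal cones\<close>

text \<open>Convergence of \<open>X + d k\<close> to \<open>X\<close> follows from that of the
  quotients, since \<open>d k\<close> is \<open>t k\<close> times a convergent sequence.\<close>

lemma bouligand_tangentI:
  fixes X \<Xi> :: "'a::real_normed_vector"
  assumes "\<And>k. X + d k \<in> \<Omega>" "\<And>k. 0 < (t k :: real)" "t \<longlonglongrightarrow> 0"
    and lim: "(\<lambda>k. inverse (t k) *\<^sub>R d k) \<longlonglongrightarrow> \<Xi>"
  shows "\<Xi> \<in> bouligand_tangent \<Omega> X"
proof -
  have "(\<lambda>k. X + t k *\<^sub>R (inverse (t k) *\<^sub>R d k)) \<longlonglongrightarrow> X + 0 *\<^sub>R \<Xi>"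
    by (intro tendsto_intros assms)
  moreover have "t k *\<^sub>R (inverse (t k) *\<^sub>R d k) = d k" for k
    using assms(2)[of k] by simp
  ultimately have "(\<lambda>k. X + d k) \<longlonglongrightarrow> X"
    by simp
  then show ?thesis
    unfolding bouligand_tangent_def using assms
    by (auto intro!: exI[of _ "\<lambda>k. X + d k"] exI[of _ t])
qed

lemma bouligand_tangent_lineI:
  fixes X \<Xi> :: "'a::real_normed_vector"
  assumes "\<And>t. X + t *\<^sub>R \<Xi> \<in> \<Omega>"
  shows "\<Xi> \<in> bouligand_tangent \<Omega> X"
proof (rule bouligand_tangentI)
  show "X + inverse (real (Suc k)) *\<^sub>R \<Xi> \<in> \<Omega>" for k
    by (rule assms)
  show "(\<lambda>k. inverse (real (Suc k))) \<longlonglongrightarrow> 0"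
    by (rule LIMSEQ_inverse_real_of_nat)
  show "(\<lambda>k. inverse (inverse (real (Suc k))) *\<^sub>R inverse (real (Suc k)) *\<^sub>R \<Xi>) \<longlonglongrightarrow> \<Xi>"
    by simp
qed simp

lemma bouligand_tangent_mono:
  "\<Omega> \<subseteq> \<Omega>' \<Longrightarrow> bouligand_tangent \<Omega> X \<subseteq> bouligand_tangent \<Omega>' X"
  unfolding bouligand_tangent_def by blast

lemma frechet_normal_antimono:
  "\<Omega> \<subseteq> \<Omega>' \<Longrightarrow> frechet_normal \<Omega>' X \<subseteq> frechet_normal \<Omega> X"
  using bouligand_tangent_mono[of \<Omega> \<Omega>' X] unfolding frechet_normal_def polar_def by blast

lemma frechet_normalD: "\<lbrakk>Y \<in> frechet_normal \<Omega> X; \<Xi> \<in> bouligand_tangent \<Omega> X\<rbrakk> \<Longrightarrow> Y \<bullet> \<Xi> \<le> 0"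
  unfolding frechet_normal_def polar_def by blast

text \<open>Shrinking a set enlarges its normal cone, so both summands lie in the normal cone of the
  intersection, which as a polar is closed under addition. This is the half of each sum rule that
  holds without a qualification.\<close>

lemma frechet_normal_add_subset_Int:
  "frechet_normal \<Omega> X + frechet_normal \<Omega>' X \<subseteq> frechet_normal (\<Omega> \<inter> \<Omega>') X"
proof
  fix Y assume "Y \<in> frechet_normal \<Omega> X + frechet_normal \<Omega>' X"
  then obtain Y1 Y2 where Y: "Y = Y1 + Y2"
    "Y1 \<in> frechet_normal (\<Omega> \<inter> \<Omega>') X" "Y2 \<in> frechet_normal (\<Omega> \<inter> \<Omega>') X"
    using frechet_normal_antimono[of "\<Omega> \<inter> \<Omega>'"] unfolding set_plus_def by blast
  then show "Y \<in> frechet_normal (\<Omega> \<inter> \<Omega>') X"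
    unfolding frechet_normal_def polar_def by (fastforce simp: inner_add_left)
qed

lemma zero_in_frechet_normal: "0 \<in> frechet_normal \<Omega> X"
  unfolding frechet_normal_def polar_def by simp

lemma frechet_normal_add_superset: "frechet_normal \<Omega> X \<subseteq> frechet_normal \<Omega> X + frechet_normal \<Omega>' X"
  using zero_in_frechet_normal[of \<Omega>' X] unfolding set_plus_def by force

text \<open>Orthogonality to all differences survives scaling and limits. This suits affine sets and
  unions of subspaces containing \<open>X\<close>.\<close>

lemma frechet_normal_orthogonalI:
  assumes "\<And>Z. Z \<in> \<Omega> \<Longrightarrow> Y \<bullet> (Z - X) = 0"
  shows "Y \<in> frechet_normal \<Omega> X"
  unfolding frechet_normal_def polar_def
proof clarify
  fix \<Xi> assume "\<Xi> \<in> bouligand_tangent \<Omega> X"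
  then obtain Xs and t :: "nat \<Rightarrow> real" where "\<And>k. Xs k \<in> \<Omega>"
    and "(\<lambda>k. inverse (t k) *\<^sub>R (Xs k - X)) \<longlonglongrightarrow> \<Xi>"
    unfolding bouligand_tangent_def by blast
  then have "(\<lambda>k. Y \<bullet> (inverse (t k) *\<^sub>R (Xs k - X))) \<longlonglongrightarrow> Y \<bullet> \<Xi>"
    by (intro tendsto_intros)
  then have "(\<lambda>k. 0) \<longlonglongrightarrow> Y \<bullet> \<Xi>"
    using assms \<open>\<And>k. Xs k \<in> \<Omega>\<close> by simp
  then show "Y \<bullet> \<Xi> \<le> 0"
    by (simp add: LIMSEQ_const_iff)
qed

lemma affine_combination_in_frechet_normal:
  assumes "X \<in> affine_constraints l A b"
  shows "(\<Sum>i\<in>{1..l}. c i *\<^sub>R A i) \<in> frechet_normal (affine_constraints l A b) X"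
  by (rule frechet_normal_orthogonalI)
    (use assms in \<open>simp add: affine_constraints_def inner_sum_left inner_diff_right\<close>)

section \<open>Dual families and correction into the linear constraints\<close>

definition dual_family :: "'i set \<Rightarrow> ('i \<Rightarrow> 'a::real_inner) \<Rightarrow> ('i \<Rightarrow> 'a) \<Rightarrow> bool" where
  "dual_family I A \<theta> \<longleftrightarrow> (\<forall>i\<in>I. \<forall>j\<in>I. A i \<bullet> \<theta> j = (if i = j then 1 else 0))"

text \<open>Removing from \<open>f j\<close> its projection onto the span of the other members
  leaves some \<open>z\<close>, nonzero by independence and orthogonal to the others; scaling by
  \<open>1 / (z \<bullet> z)\<close> normalizes its product with \<open>f j\<close>.\<close>

lemma lin_indep_family_imp_dual_family:
  fixes f :: "'i \<Rightarrow> 'a::euclidean_space"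
  assumes "lin_indep_family f I"
  obtains \<theta> where "dual_family I f \<theta>"
proof -
  have ex: "\<exists>z. \<forall>i\<in>I. f i \<bullet> z = (if i = j then 1 else 0)" if "j \<in> I" for j
  proof -
    let ?S = "f ` (I - {j})"
    \<comment> \<open>Injectivity makes dropping the index \<open>j\<close> the same as dropping the
      value \<open>f j\<close>.\<close>
    have "?S = f ` I - {f j}"
      using assms that unfolding lin_indep_family_def inj_on_def by auto
    then have notin: "f j \<notin> span ?S"
      using assms that unfolding lin_indep_family_def dependent_def by auto
    obtain y z where yz: "y \<in> span ?S" "\<And>w. w \<in> span ?S \<Longrightarrow> orthogonal z w" "f j = y + z"
      using orthogonal_subspace_decomp_exists by blast
    have "f j \<bullet> z = z \<bullet> z"
      using yz(2)[OF yz(1)] by (simp add: yz(3) inner_add_left orthogonal_def inner_commute[of y])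
    moreover have "z \<noteq> 0"
      using notin yz by auto
    moreover have "f i \<bullet> z = 0" if "i \<in> I" "i \<noteq> j" for i
      using yz(2)[of "f i"] that by (auto simp: orthogonal_def inner_commute span_base)
    ultimately show ?thesis
      by (intro exI[of _ "(1 / (z \<bullet> z)) *\<^sub>R z"]) auto
  qed
  define \<theta> where "\<theta> j = (SOME z. \<forall>i\<in>I. f i \<bullet> z = (if i = j then 1 else 0))" for j
  have "\<forall>i\<in>I. f i \<bullet> \<theta> j = (if i = j then 1 else 0)" if "j \<in> I" for j
    unfolding \<theta>_def by (rule someI_ex) (rule ex[OF that])
  then show thesis
    using that unfolding dual_family_def by blast
qed

lemma dual_family_inner_sum:
  assumes "dual_family I A \<theta>" "finite I" "i \<in> I"
  shows "A i \<bullet> (\<Sum>j\<in>I. c j *\<^sub>R \<theta> j) = c i"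
proof -
  have "A i \<bullet> (\<Sum>j\<in>I. c j *\<^sub>R \<theta> j) = (\<Sum>j\<in>I. if i = j then c j else 0)"
    unfolding inner_sum_right by (rule sum.cong) (use assms in \<open>auto simp: dual_family_def\<close>)
  then show ?thesis
    using assms(2,3) by simp
qed

text \<open>For a dual family over a finite \<open>I\<close>, this is the oblique projection along
  the span of the \<open>\<theta> j\<close> onto the common null space of the functionals given by
  the \<open>A i\<close>.\<close>

definition corrected :: "'i set \<Rightarrow> ('i \<Rightarrow> 'a::real_inner) \<Rightarrow> ('i \<Rightarrow> 'a) \<Rightarrow> 'a \<Rightarrow> 'a" where
  "corrected I A \<theta> Z = Z - (\<Sum>j\<in>I. (A j \<bullet> Z) *\<^sub>R \<theta> j)"

lemma inner_corrected:
  assumes "dual_family I A \<theta>" "finite I" "i \<in> I"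
  shows "A i \<bullet> corrected I A \<theta> Z = 0"
  using dual_family_inner_sum[OF assms, of "\<lambda>j. A j \<bullet> Z"]
  unfolding corrected_def inner_diff_right by simp

lemma corrected_minus: "corrected I A \<theta> (- Z) = - corrected I A \<theta> Z"
  unfolding corrected_def by (simp add: sum_negf)

lemma affine_constraints_translate:
  assumes "X \<in> affine_constraints l A b" "\<And>i. i \<in> {1..l} \<Longrightarrow> A i \<bullet> \<Xi> = 0"
  shows "X + \<Xi> \<in> affine_constraints l A b"
  using assms unfolding affine_constraints_def by (simp add: inner_add_right)

text \<open>Tangency in both directions makes \<open>Y\<close> orthogonal to the corrected
  direction. Subtracting the multipliers from \<open>Y\<close> is the adjoint of
  \<open>corrected\<close>, so the correction moves from \<open>Z\<close> to
  \<open>Y\<close>.\<close>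

lemma normal_minus_multipliers_orthogonal:
  assumes "Y \<in> frechet_normal \<Omega> X"
    and "corrected I A \<theta> Z \<in> bouligand_tangent \<Omega> X"
    and "corrected I A \<theta> (- Z) \<in> bouligand_tangent \<Omega> X"
  shows "(Y - (\<Sum>j\<in>I. (Y \<bullet> \<theta> j) *\<^sub>R A j)) \<bullet> Z = 0"
proof -
  have "Y \<bullet> corrected I A \<theta> Z = 0"
    using frechet_normalD[OF assms(1,2)] frechet_normalD[OF assms(1,3)]
    by (simp add: corrected_minus)
  moreover have "(\<Sum>j\<in>I. (Y \<bullet> \<theta> j) *\<^sub>R A j) \<bullet> Z = Y \<bullet> (\<Sum>j\<in>I. (A j \<bullet> Z) *\<^sub>R \<theta> j)"
    by (auto simp: inner_sum_left inner_sum_right intro!: sum.cong)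
  ultimately show ?thesis
    by (simp add: corrected_def inner_diff_left inner_diff_right)
qed

text \<open>The correction \<open>y\<close> that restores the constraints along the curve
  \<open>t \<mapsto> X + w + q w\<close>, \<open>w = t \<Xi> + \<Sum>\<^sub>j (A j \<bullet> y) \<theta> j\<close>, solves the fixed point equation
  \<open>y = - q w\<close>; Brouwer's theorem provides a solution of size \<open>O(t\<^sup>2)\<close>.\<close>

lemma bouligand_tangent_affine_Int:
  fixes X \<Xi> :: "real^'n^'m" and q :: "real^'n^'m \<Rightarrow> real^'n^'m"
  assumes X: "X \<in> affine_constraints l A b"
    and dual: "dual_family {1..l} A \<theta>"
    and T: "subspace T" "\<Xi> \<in> T" "\<And>j. j \<in> {1..l} \<Longrightarrow> \<theta> j \<in> T"
    and q: "continuous_on UNIV q" "\<And>w. norm (q w) \<le> K * (norm w)\<^sup>2"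
    and \<Omega>: "\<And>w. w \<in> T \<Longrightarrow> X + w + q w \<in> \<Omega>"
    and \<Xi>: "\<And>i. i \<in> {1..l} \<Longrightarrow> A i \<bullet> \<Xi> = 0"
  shows "\<Xi> \<in> bouligand_tangent (affine_constraints l A b \<inter> \<Omega>) X"
proof -
  \<comment> \<open>\<open>\<Theta> y\<close> changes each linear constraint exactly as
    \<open>y\<close> does but stays in \<open>T\<close>; adding \<open>\<Theta> y - y\<close> is
    therefore invisible to the constraints.\<close>
  define \<Theta> where "\<Theta> y = (\<Sum>j\<in>{1..l}. (A j \<bullet> y) *\<^sub>R \<theta> j)" for y
  have lin: "linear \<Theta>"
    unfolding \<Theta>_def by (auto intro!: linearI simp: inner_add_right scaleR_add_left sum.distrib scaleR_sum_right)
  then obtain B where B: "B > 0" "\<And>y. norm (\<Theta> y) \<le> B * norm y"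
    using linear_bounded_pos by blast
  have inner_\<Theta>: "A i \<bullet> \<Theta> y = A i \<bullet> y" if "i \<in> {1..l}" for i y
    unfolding \<Theta>_def using dual_family_inner_sum[OF dual _ that, of "\<lambda>j. A j \<bullet> y"] by simp
  have \<Theta>T: "\<Theta> y \<in> T" for y
    unfolding \<Theta>_def by (intro subspace_sum subspace_scale T)
  \<comment> \<open>If \<open>norm y \<le> \<rho> * t\<^sup>2\<close> and
    \<open>B * \<rho> * t \<le> 1\<close>, the argument of \<open>q\<close> has norm at most
    \<open>t * (norm \<Xi> + 1)\<close>; this choice of \<open>\<rho>\<close> then makes the ball
    invariant.\<close>
  define \<rho> where "\<rho> = \<bar>K\<bar> * (norm \<Xi> + 1)\<^sup>2"
  have \<rho>: "\<rho> \<ge> 0"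
    unfolding \<rho>_def by simp
  have ex: "\<exists>y. norm y \<le> \<rho> * t\<^sup>2 \<and> y = - q (t *\<^sub>R \<Xi> + \<Theta> y)" if t: "0 < t" "B * \<rho> * t \<le> 1" for t
  proof -
    have bound: "norm (q (t *\<^sub>R \<Xi> + \<Theta> y)) \<le> \<rho> * t\<^sup>2" if "norm y \<le> \<rho> * t\<^sup>2" for y
    proof -
      have "norm (t *\<^sub>R \<Xi> + \<Theta> y) \<le> t * norm \<Xi> + B * (\<rho> * t\<^sup>2)"
      proof -
        have "norm (t *\<^sub>R \<Xi> + \<Theta> y) \<le> t * norm \<Xi> + norm (\<Theta> y)"
          using norm_triangle_ineq[of "t *\<^sub>R \<Xi>" "\<Theta> y"] t(1) by simp
        moreover have "B * norm y \<le> B * (\<rho> * t\<^sup>2)"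
          using that B(1) by (intro mult_left_mono) auto
        ultimately show ?thesis
          using B(2)[of y] by linarith
      qed
      also have "\<dots> \<le> t * norm \<Xi> + t * 1"
        using mult_left_mono[OF t(2), of t] t(1) by (simp add: power2_eq_square algebra_simps)
      finally have "norm (t *\<^sub>R \<Xi> + \<Theta> y) \<le> t * (norm \<Xi> + 1)"
        by (simp add: algebra_simps)
      then have "(norm (t *\<^sub>R \<Xi> + \<Theta> y))\<^sup>2 \<le> (t * (norm \<Xi> + 1))\<^sup>2"
        by (rule power_mono) simp
      then have "\<bar>K\<bar> * (norm (t *\<^sub>R \<Xi> + \<Theta> y))\<^sup>2 \<le> \<bar>K\<bar> * (t * (norm \<Xi> + 1))\<^sup>2"
        by (rule mult_left_mono) simp
      moreover have "K * (norm (t *\<^sub>R \<Xi> + \<Theta> y))\<^sup>2 \<le> \<bar>K\<bar> * (norm (t *\<^sub>R \<Xi> + \<Theta> y))\<^sup>2"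
        by (rule mult_right_mono) auto
      ultimately show ?thesis
        using q(2)[of "t *\<^sub>R \<Xi> + \<Theta> y"] by (simp add: \<rho>_def power_mult_distrib mult_ac)
    qed
    have "continuous_on UNIV (\<lambda>y. - q (t *\<^sub>R \<Xi> + \<Theta> y))"
      by (intro continuous_intros continuous_on_compose2[OF q(1)] linear_continuous_on
          lin[unfolded linear_conv_bounded_linear]) auto
    then have "continuous_on (cball 0 (\<rho> * t\<^sup>2)) (\<lambda>y. - q (t *\<^sub>R \<Xi> + \<Theta> y))"
      by (rule continuous_on_subset) simp
    moreover have "(\<lambda>y. - q (t *\<^sub>R \<Xi> + \<Theta> y)) \<in> cball 0 (\<rho> * t\<^sup>2) \<rightarrow> cball 0 (\<rho> * t\<^sup>2)"
      using bound by auto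
    moreover have "0 \<le> \<rho> * t\<^sup>2"
      using \<rho> by simp
    ultimately obtain y where "y \<in> cball 0 (\<rho> * t\<^sup>2)" "- q (t *\<^sub>R \<Xi> + \<Theta> y) = y"
      using brouwer[of "cball 0 (\<rho> * t\<^sup>2)" "\<lambda>y. - q (t *\<^sub>R \<Xi> + \<Theta> y)"] by force
    then show ?thesis
      by (intro exI[of _ y]) auto
  qed
  \<comment> \<open>The first factor enforces \<open>B * \<rho> * t k \<le> 1\<close>; the added 1
    keeps it positive when \<open>\<rho> = 0\<close>.\<close>
  define t where "t k = inverse (B * \<rho> + 1) * inverse (real (Suc k))" for k
  have pos: "B * \<rho> + 1 > 0"
    using B \<rho> by (simp add: add_nonneg_pos)
  have t: "0 < t k" "B * \<rho> * t k \<le> 1" for k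
  proof -
    show "0 < t k"
      unfolding t_def using pos by simp
    have "B * \<rho> * t k \<le> (B * \<rho> + 1) * t k"
      using \<open>0 < t k\<close> by (simp add: mult_right_mono)
    also have "\<dots> = inverse (real (Suc k))"
      unfolding t_def using pos by simp
    also have "\<dots> \<le> 1"
      by (simp add: field_simps)
    finally show "B * \<rho> * t k \<le> 1" .
  qed
  have t0: "t \<longlonglongrightarrow> 0"
    unfolding t_def using tendsto_mult_right_zero[OF LIMSEQ_inverse_real_of_nat] by blast
  have "\<forall>k. \<exists>y. norm y \<le> \<rho> * (t k)\<^sup>2 \<and> y = - q (t k *\<^sub>R \<Xi> + \<Theta> y)"
    using ex t by blast
  then obtain y where y: "\<And>k. norm (y k) \<le> \<rho> * (t k)\<^sup>2" "\<And>k. y k = - q (t k *\<^sub>R \<Xi> + \<Theta> (y k))"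
    by metis
  \<comment> \<open>This form shows that the linear constraints are kept; rewritten by the fixed
    point equation, \<open>d k\<close> puts the point on the curve inside
    \<open>\<Omega>\<close>.\<close>
  define d where "d k = t k *\<^sub>R \<Xi> + (\<Theta> (y k) - y k)" for k
  have d: "d k = (t k *\<^sub>R \<Xi> + \<Theta> (y k)) + q (t k *\<^sub>R \<Xi> + \<Theta> (y k))" for k
    unfolding d_def by (subst (2) y(2)) simp
  show ?thesis
  proof (rule bouligand_tangentI)
    fix k
    have "t k *\<^sub>R \<Xi> + \<Theta> (y k) \<in> T"
      by (intro subspace_add subspace_scale T \<Theta>T)
    then have "X + d k \<in> \<Omega>"
      using \<Omega>[of "t k *\<^sub>R \<Xi> + \<Theta> (y k)"] unfolding d by (simp add: add.assoc)
    moreover have "X + d k \<in> affine_constraints l A b"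
      by (rule affine_constraints_translate[OF X])
        (simp add: d_def inner_add_right inner_diff_right \<Xi> inner_\<Theta>)
    ultimately show "X + d k \<in> affine_constraints l A b \<inter> \<Omega>"
      by blast
    show "0 < t k"
      by (rule t)
  next
    show "t \<longlonglongrightarrow> 0"
      by (rule t0)
    have "(\<lambda>k. inverse (t k) *\<^sub>R (\<Theta> (y k) - y k)) \<longlonglongrightarrow> 0"
    proof (rule Lim_null_comparison)
      show "\<forall>\<^sub>F k in sequentially. norm (inverse (t k) *\<^sub>R (\<Theta> (y k) - y k)) \<le> (B + 1) * \<rho> * t k"
      proof (intro always_eventually allI)
        fix k
        have "norm (\<Theta> (y k) - y k) \<le> (B + 1) * norm (y k)"
          using norm_triangle_ineq4[of "\<Theta> (y k)" "y k"] B(2)[of "y k"] by (simp add: algebra_simps)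
        also have "\<dots> \<le> (B + 1) * (\<rho> * (t k)\<^sup>2)"
          using y(1)[of k] B(1) by (simp add: mult_left_mono)
        finally have "inverse (t k) * norm (\<Theta> (y k) - y k) \<le> inverse (t k) * ((B + 1) * (\<rho> * (t k)\<^sup>2))"
          using t(1)[of k] by (intro mult_left_mono) auto
        also have "\<dots> = (B + 1) * \<rho> * t k"
          using t(1)[of k] by (simp add: power2_eq_square field_simps)
        finally show "norm (inverse (t k) *\<^sub>R (\<Theta> (y k) - y k)) \<le> (B + 1) * \<rho> * t k"
          using t(1)[of k] by simp
      qed
      show "(\<lambda>k. (B + 1) * \<rho> * t k) \<longlonglongrightarrow> 0"
        using tendsto_mult_right_zero[OF t0] by blast
    qed
    then have "(\<lambda>k. \<Xi> + inverse (t k) *\<^sub>R (\<Theta> (y k) - y k)) \<longlonglongrightarrow> \<Xi> + 0"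
      by (intro tendsto_intros)
    moreover have "inverse (t k) *\<^sub>R d k = \<Xi> + inverse (t k) *\<^sub>R (\<Theta> (y k) - y k)" for k
      using t(1)[of k] unfolding d_def by (simp add: scaleR_add_right)
    ultimately show "(\<lambda>k. inverse (t k) *\<^sub>R d k) \<longlonglongrightarrow> \<Xi>"
      by simp
  qed
qed

section \<open>Null spaces and tangent vectors under a rank bound\<close>

lemma bounded_bilinear_matrix_matrix_mult:
  "bounded_bilinear ((**) :: real^'n^'m \<Rightarrow> real^'p^'n \<Rightarrow> real^'p^'m)"
  unfolding bilinear_conv_bounded_bilinear[symmetric] bilinear_def
  by (auto intro!: linearI
      simp: matrix_matrix_mult_def vec_eq_iff sum_distrib_left sum.distrib algebra_simps)

lemma bounded_bilinear_matrix_vector_mult: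
  "bounded_bilinear ((*v) :: real^'n^'m \<Rightarrow> real^'n \<Rightarrow> real^'m)"
  unfolding bilinear_conv_bounded_bilinear[symmetric] bilinear_def
  by (auto intro!: linearI
      simp: matrix_vector_mult_def vec_eq_iff sum_distrib_left sum.distrib algebra_simps)

text \<open>The null space is the orthogonal complement of the row space.\<close>

lemma dim_nullspace:
  fixes M :: "real^'n^'m"
  shows "dim {x. M *v x = 0} + rank M = CARD('n)"
proof -
  have "{x. M *v x = 0} = {y \<in> UNIV. \<forall>x\<in>rows M. orthogonal x y}" (is "?N = _")
    by (auto simp: rows_def orthogonal_def vec_eq_iff[of "M *v _"] matrix_vector_mul_component row_def)
  also have "\<dots> = {y \<in> UNIV. \<forall>x\<in>span (rows M). orthogonal x y}"
    using orthogonal_to_span[of _ "rows M"] by (auto intro: span_base) (metis orthogonal_commute)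
  finally have "dim ?N + dim (span (rows M)) = dim (UNIV :: (real^'n) set)"
    using dim_subspace_orthogonal_to_vectors[of "span (rows M)" UNIV] by simp
  then show ?thesis
    by (simp add: row_rank_def)
qed

text \<open>If the rank does not go up along the sequence, the null spaces are large enough to be
  complements of the row space of the limit, so \<open>v\<close> splits as \<open>x + c\<close> with \<open>x\<close> in the
  null space of \<open>Xs k\<close> and \<open>c\<close> in the row space of \<open>X\<close>, where \<open>X\<close> is bounded below.\<close>

lemma nullspace_vector_limit:
  fixes X :: "real^'n^'m"
  assumes lim: "Xs \<longlonglongrightarrow> X" and rank: "\<And>k. rank (Xs k) \<le> rank X" and v: "X *v v = 0"
  obtains vs where "vs \<longlonglongrightarrow> v" "\<forall>\<^sub>F k in sequentially. Xs k *v vs k = 0"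
proof -
  obtain K where K: "K > 0" "\<And>(M::real^'n^'m) x. norm (M *v x) \<le> norm M * norm x * K"
    using bounded_bilinear.pos_bounded[OF bounded_bilinear_matrix_vector_mult] by blast
  obtain c where c: "c > 0" "\<And>x. x \<in> span (rows X) \<Longrightarrow> c * norm x \<le> norm (X *v x)"
    using injective_imp_isometric[OF closed_subspace[OF subspace_span] subspace_span
        matrix_vector_mul_bounded_linear, of "rows X" X] nullspace_inter_rowspace[of X] by blast
  define \<epsilon> where "\<epsilon> k = K * norm (Xs k - X)" for k
  have \<epsilon>: "norm ((Xs k - X) *v x) \<le> \<epsilon> k * norm x" for k x
    using K(2)[of "Xs k - X" x] unfolding \<epsilon>_def by (simp add: mult_ac)
  have \<epsilon>0: "\<epsilon> \<longlonglongrightarrow> 0"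
    unfolding \<epsilon>_def using lim by (intro tendsto_mult_right_zero tendsto_norm_zero) (simp add: LIM_zero)
  have split: "\<exists>x. Xs k *v x = 0 \<and> v - x \<in> span (rows X)" if "\<epsilon> k < c" for k
  proof -
    let ?N = "{x. Xs k *v x = 0}" and ?R = "span (rows X)"
    have N: "subspace ?N"
      by (auto simp: subspace_def matrix_vector_right_distrib matrix_vector_mult_scaleR)
    \<comment> \<open>On the null space of \<open>Xs k\<close>, \<open>X\<close> acts as
      \<open>X - Xs k\<close>, which is too small for the lower bound \<open>c\<close> on the row
      space unless \<open>x = 0\<close>.\<close>
    have "x = 0" if x: "x \<in> ?N \<inter> ?R" for x
    proof -
      have "c * norm x \<le> norm (X *v x)"
        using c(2) x by blast
      also have "\<dots> = norm ((Xs k - X) *v x)"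
        using x by (simp add: matrix_vector_mult_diff_rdistrib)
      also have "\<dots> \<le> \<epsilon> k * norm x"
        by (rule \<epsilon>)
      finally show ?thesis
        using \<open>\<epsilon> k < c\<close> by (auto simp: mult_le_cancel_right)
    qed
    then have "?N \<inter> ?R \<subseteq> {0}"
      by blast
    then have dim0: "dim (?N \<inter> ?R) = 0"
      using dim_subset[of "?N \<inter> ?R" "{0}"] by simp
    \<comment> \<open>The null space of \<open>Xs k\<close> has dimension at least
      \<open>CARD('n) - rank X\<close> and the row space has dimension \<open>rank X\<close>;
      meeting trivially, they span everything.\<close>
    have "dim {x + y |x y. x \<in> ?N \<and> y \<in> ?R} \<ge> DIM(real^'n)"
      using dim_sums_Int[OF N subspace_span, of "rows X"] dim_nullspace[of "Xs k"] rank[of k]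
      unfolding row_rank_def dim0 by simp
    then have "span {x + y |x y. x \<in> ?N \<and> y \<in> ?R} = UNIV"
      using dim_eq_full dim_subset_UNIV le_antisym by blast
    then have "v \<in> {x + y |x y. x \<in> ?N \<and> y \<in> ?R}"
      using subspace_sums[OF N subspace_span, of "rows X"] by (metis (no_types, lifting) UNIV_I span_eq_iff)
    then show ?thesis
      by auto
  qed
  define vs where "vs k = (SOME x. Xs k *v x = 0 \<and> v - x \<in> span (rows X))" for k
  \<comment> \<open>Half of \<open>c\<close> leaves room to absorb
    \<open>\<epsilon> k * norm (vs k - v)\<close> into the left-hand side of the estimate
    below.\<close>
  have small: "\<forall>\<^sub>F k in sequentially. \<epsilon> k < c / 2"
    using order_tendstoD(2)[OF \<epsilon>0, of "c / 2"] c(1) by simp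
  have vs: "Xs k *v vs k = 0" "v - vs k \<in> span (rows X)" if "\<epsilon> k < c / 2" for k
    using someI_ex[OF split[of k]] that c(1) unfolding vs_def by auto
  have "(\<lambda>k. vs k - v) \<longlonglongrightarrow> 0"
  proof (rule Lim_null_comparison)
    show "\<forall>\<^sub>F k in sequentially. norm (vs k - v) \<le> (2 / c * norm v) * \<epsilon> k"
      using small
    proof eventually_elim
      case (elim k)
      have "c * norm (vs k - v) \<le> norm (X *v (v - vs k))"
        using c(2)[OF vs(2)[OF elim]] by (simp add: norm_minus_commute)
      also have "\<dots> = norm ((Xs k - X) *v vs k)"
        using v vs(1)[OF elim] by (simp add: matrix_vector_mult_diff_rdistrib matrix_vector_mult_diff_distrib)
      also have "\<dots> \<le> \<epsilon> k * norm (vs k)"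
        by (rule \<epsilon>)
      also have "\<dots> \<le> \<epsilon> k * (norm v + norm (vs k - v))"
        using K(1) norm_triangle_ineq[of v "vs k - v"] unfolding \<epsilon>_def by (intro mult_left_mono) auto
      also have "\<dots> \<le> \<epsilon> k * norm v + c / 2 * norm (vs k - v)"
        using mult_right_mono[of "\<epsilon> k" "c / 2" "norm (vs k - v)"] elim by (simp add: distrib_left)
      finally show ?case
        using c(1) by (simp add: field_simps)
    qed
    show "(\<lambda>k. (2 / c * norm v) * \<epsilon> k) \<longlonglongrightarrow> 0"
      by (rule tendsto_mult_right_zero[OF \<epsilon>0])
  qed
  then have "vs \<longlonglongrightarrow> v"
    by (simp add: LIM_zero_iff)
  moreover have "\<forall>\<^sub>F k in sequentially. Xs k *v vs k = 0"
    using small by eventually_elim (rule vs)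
  ultimately show thesis
    by (rule that)
qed

text \<open>Choose null vectors \<open>vs k\<close> of \<open>Xs k\<close> tending to
  \<open>v\<close>. Since \<open>u\<close> annihilates the range of \<open>X\<close>, the difference
  quotients paired with \<open>u\<close> and \<open>vs k\<close> eventually vanish, and so does
  their limit.\<close>

lemma tangent_rank_le_kernel:
  fixes X \<Xi> :: "real^'n^'m"
  assumes "\<Xi> \<in> bouligand_tangent (rank_le (rank X)) X" and v: "X *v v = 0" and u: "transpose X *v u = 0"
  shows "u \<bullet> (\<Xi> *v v) = 0"
proof -
  obtain Xs t where X: "\<And>k::nat. rank (Xs k) \<le> rank X" "Xs \<longlonglongrightarrow> X"
    and t: "(\<lambda>k. inverse (t k) *\<^sub>R (Xs k - X)) \<longlonglongrightarrow> \<Xi>"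
    using assms(1) unfolding bouligand_tangent_def rank_le_def by blast
  obtain vs where vs: "vs \<longlonglongrightarrow> v" "\<forall>\<^sub>F k in sequentially. Xs k *v vs k = 0"
    using nullspace_vector_limit[OF X(2,1) v] by blast
  have uX: "u \<bullet> (X *v y) = 0" for y
    using u by (metis dot_lmul_matrix inner_zero_left vector_transpose_matrix transpose_transpose)
  have "(\<lambda>k. u \<bullet> ((inverse (t k) *\<^sub>R (Xs k - X)) *v vs k)) \<longlonglongrightarrow> u \<bullet> (\<Xi> *v v)"
    by (intro tendsto_intros bounded_bilinear.tendsto[OF bounded_bilinear_matrix_vector_mult] t vs)
  moreover have "\<forall>\<^sub>F k in sequentially. u \<bullet> ((inverse (t k) *\<^sub>R (Xs k - X)) *v vs k) = 0"
    using vs(2)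
    by eventually_elim
      (simp add: scaleR_matrix_vector_assoc[symmetric] matrix_vector_mult_diff_rdistrib inner_diff_right uX)
  ultimately have "(\<lambda>k. 0) \<longlonglongrightarrow> u \<bullet> (\<Xi> *v v)"
    by (rule Lim_transform_eventually)
  then show ?thesis
    by (simp add: LIMSEQ_const_iff)
qed


section \<open>Trace inner product, rank and supports of entries\<close>

lemmas matrix_mult_bilinear_simps =
  bounded_bilinear.add_left[OF bounded_bilinear_matrix_matrix_mult]
  bounded_bilinear.add_right[OF bounded_bilinear_matrix_matrix_mult]
  bounded_bilinear.diff_left[OF bounded_bilinear_matrix_matrix_mult]
  bounded_bilinear.diff_right[OF bounded_bilinear_matrix_matrix_mult]
  bounded_bilinear.scaleR_left[OF bounded_bilinear_matrix_matrix_mult]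
  bounded_bilinear.scaleR_right[OF bounded_bilinear_matrix_matrix_mult]

lemma inner_matrix_mult_left:
  fixes M :: "real^'k^'m" and P :: "real^'n^'k" and Y :: "real^'n^'m"
  shows "Y \<bullet> (M ** P) = (transpose M ** Y) \<bullet> P"
proof -
  have "Y \<bullet> (M ** P) = (\<Sum>i\<in>UNIV. \<Sum>j\<in>UNIV. \<Sum>k\<in>UNIV. Y$i$j * (M$i$k * P$k$j))"
    by (simp add: inner_vec_def matrix_matrix_mult_def sum_distrib_left)
  also have "\<dots> = (\<Sum>j\<in>UNIV. \<Sum>i\<in>UNIV. \<Sum>k\<in>UNIV. Y$i$j * (M$i$k * P$k$j))"
    by (rule sum.swap)
  also have "\<dots> = (\<Sum>j\<in>UNIV. \<Sum>k\<in>UNIV. \<Sum>i\<in>UNIV. Y$i$j * (M$i$k * P$k$j))"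
    by (intro sum.cong refl sum.swap)
  also have "\<dots> = (\<Sum>k\<in>UNIV. \<Sum>j\<in>UNIV. \<Sum>i\<in>UNIV. Y$i$j * (M$i$k * P$k$j))"
    by (rule sum.swap)
  also have "\<dots> = (transpose M ** Y) \<bullet> P"
    by (simp add: inner_vec_def matrix_matrix_mult_def transpose_def sum_distrib_left sum_distrib_right mult_ac)
  finally show ?thesis .
qed

lemma inner_matrix_transpose: "transpose Y \<bullet> transpose Z = Y \<bullet> (Z :: real^'n^'m)"
  unfolding inner_vec_def transpose_def by (simp, rule sum.swap)

lemma inner_matrix_mult_right:
  fixes M :: "real^'n^'k" and P :: "real^'k^'m" and Y :: "real^'n^'m"
  shows "Y \<bullet> (P ** M) = (Y ** transpose M) \<bullet> P"
  using inner_matrix_mult_left[of "transpose Y" "transpose M" "transpose P"]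
    inner_matrix_transpose[of Y "P ** M"] inner_matrix_transpose[of "Y ** transpose M" P]
  by (simp add: matrix_transpose_mul)

lemma rank_le_card_nonzero_rows:
  fixes P :: "real^'n^'m"
  assumes "\<And>i. i \<notin> R \<Longrightarrow> row i P = 0"
  shows "rank P \<le> card R"
proof -
  have "rows P \<subseteq> span ((\<lambda>i. row i P) ` R)"
    using assms by (auto simp: rows_def) (metis imageI span_base span_zero)
  then have "rank P \<le> card ((\<lambda>i. row i P) ` R)"
    unfolding row_rank_def by (intro dim_le_card) auto
  also have "\<dots> \<le> card R"
    by (rule card_image_le) simp
  finally show ?thesis .
qed

text \<open>Columns with a nonzero singular value are nonzero multiples of coordinate vectors,
  distinct because \<open>e\<close> is injective.\<close>

lemma card_sv_support_le_rank:
  assumes "inj e"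
  shows "card (sv_support \<sigma>) \<le> rank (rect_diag e \<sigma> :: real^'n^'m)"
proof -
  let ?B = "(\<lambda>j. axis (e j) 1 :: real^'m) ` sv_support \<sigma>"
  have "axis (e j) 1 \<in> span (columns (rect_diag e \<sigma> :: real^'n^'m))" if "j \<in> sv_support \<sigma>" for j
  proof -
    have "axis (e j) 1 = (1 / \<sigma> $ j) *\<^sub>R column j (rect_diag e \<sigma> :: real^'n^'m)"
      using that by (auto simp: sv_support_def vec_eq_iff column_def rect_diag_def axis_def)
    then show ?thesis
      by (metis (mono_tags, lifting) columns_def mem_Collect_eq span_base span_scale UNIV_I)
  qed
  moreover have "independent ?B"
    by (rule independent_mono[OF independent_Basis]) (auto simp: axis_in_Basis_iff)
  ultimately have "card ?B \<le> dim (span (columns (rect_diag e \<sigma> :: real^'n^'m)))"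
    by (intro independent_card_le_dim) auto
  moreover have "card ?B = card (sv_support \<sigma>)"
    using assms by (intro card_image inj_onI) (auto simp: axis_eq_axis inj_def)
  ultimately show ?thesis
    by (simp add: column_rank_def)
qed

lemma corrected_in_subspace:
  assumes "subspace T" "Z \<in> T" "\<And>j. \<theta> j \<in> T"
  shows "corrected I A \<theta> Z \<in> T"
  unfolding corrected_def by (intro subspace_diff subspace_sum subspace_scale assms)

definition supported :: "('m \<times> 'n) set \<Rightarrow> (real^'n^'m) set" where
  "supported S = {P. \<forall>i j. (i, j) \<notin> S \<longrightarrow> P $ i $ j = 0}"

lemma subspace_supported: "subspace (supported S)"
  by (auto simp: subspace_def supported_def)

lemma supported_mono: "S \<subseteq> S' \<Longrightarrow> supported S \<subseteq> supported S'"
  by (auto simp: supported_def)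

lemma supportedD: "\<lbrakk>P \<in> supported S; (i, j) \<notin> S\<rbrakk> \<Longrightarrow> P $ i $ j = 0"
  by (simp add: supported_def)

text \<open>The orthogonal projection onto \<open>supported S\<close>; its self-adjointness is
  \<open>inner_mask\<close>.\<close>

definition mask :: "('m \<times> 'n) set \<Rightarrow> real^'n^'m \<Rightarrow> real^'n^'m" where
  "mask S P = (\<chi> i j. if (i, j) \<in> S then P $ i $ j else 0)"

lemma mask_in_supported: "mask S P \<in> supported S"
  by (simp add: mask_def supported_def)

lemma inner_mask: "P \<bullet> mask S Q = mask S P \<bullet> Q"
  unfolding inner_vec_def mask_def by (auto intro!: sum.cong)

lemma inner_axis_axis_matrix: "P \<bullet> axis i (axis j 1) = (P :: real^'n^'m) $ i $ j"
  by (simp add: inner_axis)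

lemma axis_axis_in_supported: "(i, j) \<in> S \<Longrightarrow> axis i (axis j 1) \<in> supported S"
  by (auto simp: supported_def axis_def)

section \<open>Coordinates adapted to the singular value decomposition\<close>

locale svd =
  fixes e :: "'n::finite \<Rightarrow> 'm::finite" and X :: "real^'n^'m" and U :: "real^'m^'m"
    and \<sigma> :: "real^'n" and V :: "real^'n^'n"
  assumes inj_e: "inj e" and svd: "is_svd e X U \<sigma> V"
begin

abbreviation "\<Gamma> \<equiv> sv_support \<sigma>"

abbreviation D :: "real^'n^'m" where "D \<equiv> rect_diag e \<sigma>"

text \<open>An isometry that takes \<open>X\<close> to the diagonal \<open>D\<close> and turns the
  block conditions into conditions on the positions of nonzero entries.\<close>

definition rot :: "real^'n^'m \<Rightarrow> real^'n^'m" where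
  "rot Y = transpose U ** Y ** V"

definition unrot :: "real^'n^'m \<Rightarrow> real^'n^'m" where
  "unrot P = U ** P ** transpose V"

lemma orthogonal_factors:
  "transpose U ** U = mat 1" "U ** transpose U = mat 1"
  "transpose V ** V = mat 1" "V ** transpose V = mat 1"
  using svd unfolding is_svd_def orthogonal_matrix_def by auto

lemma rot_unrot [simp]: "rot (unrot P) = P"
proof -
  have "rot (unrot P) = (transpose U ** U) ** P ** (transpose V ** V)"
    unfolding rot_def unrot_def by (simp only: matrix_mul_assoc)
  then show ?thesis
    by (simp add: orthogonal_factors)
qed

lemma unrot_rot [simp]: "unrot (rot Y) = Y"
proof -
  have "unrot (rot Y) = (U ** transpose U) ** Y ** (V ** transpose V)"
    unfolding rot_def unrot_def by (simp only: matrix_mul_assoc)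
  then show ?thesis
    by (simp add: orthogonal_factors)
qed

lemma X_eq: "X = unrot D"
  using svd unfolding is_svd_def unrot_def by blast

lemma rot_X: "rot X = D"
  by (simp add: X_eq)

lemma linear_rot: "linear rot"
  by (rule linearI) (simp_all add: rot_def matrix_mult_bilinear_simps)

lemma linear_unrot: "linear unrot"
  by (rule linearI) (simp_all add: unrot_def matrix_mult_bilinear_simps)

lemma inner_unrot: "Y \<bullet> unrot P = rot Y \<bullet> P"
  unfolding unrot_def rot_def
  by (simp add: inner_matrix_mult_right[of Y "U ** P"] inner_matrix_mult_left[of "Y ** V"] matrix_mul_assoc)

lemma inner_rot: "rot Y \<bullet> rot Z = Y \<bullet> Z"
  by (metis inner_unrot unrot_rot)

lemma rank_unrot_le: "rank (unrot P) \<le> rank P"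
  unfolding unrot_def by (meson order_trans rank_mul_le_left rank_mul_le_right)

lemma rank_D_le: "rank D \<le> rank X"
  unfolding rot_X[symmetric] rot_def by (meson order_trans rank_mul_le_left rank_mul_le_right)

lemma card_\<Gamma>_le: "card \<Gamma> \<le> rank X"
  using card_sv_support_le_rank[OF inj_e, of \<sigma>] rank_D_le by linarith

definition supp_space :: "('m \<times> 'n) set \<Rightarrow> (real^'n^'m) set" where
  "supp_space S = {Y. rot Y \<in> supported S}"

lemma subspace_supp_space: "subspace (supp_space S)"
  using linear_subspace_vimage[OF linear_rot subspace_supported, of S]
  unfolding supp_space_def vimage_def by simp

lemma D_in_supported: "\<Gamma> \<subseteq> J \<Longrightarrow> D \<in> supported (e ` J \<times> J)"
  by (auto simp: supported_def rect_diag_def sv_support_def)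

lemma X_in_supp_space: "\<Gamma> \<subseteq> J \<Longrightarrow> X \<in> supp_space (e ` J \<times> J)"
  unfolding supp_space_def by (simp add: rot_X D_in_supported)

lemma unrot_block_entry:
  assumes "P \<in> supported (e ` J \<times> J)"
  shows "unrot P $ i $ j = (\<Sum>p\<in>J. \<Sum>q\<in>J. U $ i $ e p * P $ e p $ q * V $ j $ q)"
proof -
  have "unrot P $ i $ j = (\<Sum>q\<in>UNIV. \<Sum>k\<in>UNIV. U $ i $ k * P $ k $ q * V $ j $ q)"
    by (simp add: unrot_def matrix_matrix_mult_def transpose_def sum_distrib_right)
  also have "\<dots> = (\<Sum>k\<in>UNIV. \<Sum>q\<in>UNIV. U $ i $ k * P $ k $ q * V $ j $ q)"
    by (rule sum.swap)
  also have "\<dots> = (\<Sum>k\<in>UNIV. \<Sum>q\<in>J. U $ i $ k * P $ k $ q * V $ j $ q)"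
    by (intro sum.cong refl sum.mono_neutral_right) (auto simp: supportedD[OF assms])
  also have "\<dots> = (\<Sum>k\<in>e ` J. \<Sum>q\<in>J. U $ i $ k * P $ k $ q * V $ j $ q)"
    by (intro sum.mono_neutral_right) (auto simp: supportedD[OF assms])
  also have "\<dots> = (\<Sum>p\<in>J. \<Sum>q\<in>J. U $ i $ e p * P $ e p $ q * V $ j $ q)"
    using inj_e by (subst sum.reindex) (auto intro: inj_on_subset)
  finally show ?thesis .
qed

text \<open>Identifies each piece of \<open>RX\<close> as a linear subspace given by a support
  condition, so that lines within it can be followed.\<close>

lemma RX_J_eq: "RX_J e U V J = supp_space (e ` J \<times> J)"
proof (intro equalityI subsetI)
  fix M assume "M \<in> RX_J e U V J"
  then obtain B :: "'n \<Rightarrow> 'n \<Rightarrow> real"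
    where M: "M = (\<chi> i j. \<Sum>p\<in>J. \<Sum>q\<in>J. U $ i $ e p * B p q * V $ j $ q)"
    unfolding RX_J_def by blast
  define P :: "real^'n^'m" where
    "P = (\<chi> i q. if i \<in> e ` J \<and> q \<in> J then B (inv e i) q else 0)"
  have P: "P \<in> supported (e ` J \<times> J)"
    by (auto simp: P_def supported_def)
  have "M = unrot P"
    unfolding vec_eq_iff unrot_block_entry[OF P] M
    by (auto simp: P_def inv_f_f[OF inj_e] intro!: sum.cong)
  then show "M \<in> supp_space (e ` J \<times> J)"
    using P by (simp add: supp_space_def)
next
  fix M assume "M \<in> supp_space (e ` J \<times> J)"
  then have "rot M \<in> supported (e ` J \<times> J)"
    by (simp add: supp_space_def)
  from unrot_block_entry[OF this]
  have "M = (\<chi> i j. \<Sum>p\<in>J. \<Sum>q\<in>J. U $ i $ e p * rot M $ e p $ q * V $ j $ q)"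
    by (simp add: vec_eq_iff)
  then show "M \<in> RX_J e U V J"
    unfolding RX_J_def by (auto intro!: exI[of _ "\<lambda>p q. rot M $ e p $ q"])
qed

lemma RX_eq: "RX e U \<sigma> V r = (\<Union>J\<in>{J. card J = r \<and> \<Gamma> \<subseteq> J}. supp_space (e ` J \<times> J))"
  unfolding RX_def RX_J_eq ..

lemma RX_subset_rank_le: "RX e U \<sigma> V r \<subseteq> rank_le r"
proof
  fix M assume "M \<in> RX e U \<sigma> V r"
  then obtain J where J: "card J = r" "rot M \<in> supported (e ` J \<times> J)"
    unfolding RX_eq supp_space_def by auto
  have "rank M \<le> rank (rot M)"
    using rank_unrot_le[of "rot M"] by simp
  also have "\<dots> \<le> card (e ` J)"
    by (rule rank_le_card_nonzero_rows) (auto simp: row_def vec_eq_iff supportedD[OF J(2)])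
  also have "\<dots> \<le> r"
    using card_image_le[of J e] J(1) by simp
  finally show "M \<in> rank_le r"
    by (simp add: rank_le_def)
qed

text \<open>Masking the dual vectors once more changes no pairing with the masked matrices.
  Self-adjointness of the mask then turns these into pairings with the \<open>A i\<close>
  themselves.\<close>

lemma dual_family_in_supp_space:
  assumes "lin_indep_family (\<lambda>i. mask S (rot (A i))) I"
  obtains \<theta> where "dual_family I A \<theta>" "\<And>j. \<theta> j \<in> supp_space S"
proof -
  obtain \<theta> where \<theta>: "dual_family I (\<lambda>i. mask S (rot (A i))) \<theta>"
    using lin_indep_family_imp_dual_family[OF assms] by blast
  show thesis
  proof
    show "dual_family I A (\<lambda>j. unrot (mask S (\<theta> j)))"
      using \<theta> unfolding dual_family_def by (simp add: inner_unrot inner_mask)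
    show "unrot (mask S (\<theta> j)) \<in> supp_space S" for j
      by (simp add: supp_space_def mask_in_supported)
  qed
qed

definition R_index :: "('m \<times> 'n) set" where
  "R_index = e ` \<Gamma> \<times> \<Gamma>"

definition T_index :: "('m \<times> 'n) set" where
  "T_index = {(i, j). i \<in> e ` \<Gamma> \<or> j \<in> \<Gamma>}"

lemma R_block_eq: "R_block e U \<sigma> V Y = mask R_index (rot Y)"
  by (simp add: R_block_def mask_def R_index_def rot_def)

lemma T_block_eq: "T_block e U \<sigma> V Y = mask T_index (rot Y)"
  by (simp add: T_block_def mask_def T_index_def rot_def)

section \<open>Tangent lines: the sum rule for \<open>RX\<close> and ranks below
  \<open>r\<close>\<close>

lemma corrected_line_in_affine:
  assumes "X \<in> affine_constraints l A b" "dual_family {1..l} A \<theta>"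
  shows "X + t *\<^sub>R corrected {1..l} A \<theta> Z \<in> affine_constraints l A b"
  by (rule affine_constraints_translate[OF assms(1)]) (simp add: inner_corrected[OF assms(2)] del: One_nat_def)

lemma corrected_tangent_RX:
  assumes "X \<in> affine_constraints l A b" "dual_family {1..l} A \<theta>" "\<And>j. \<theta> j \<in> supp_space R_index"
    and J: "card J = r" "\<Gamma> \<subseteq> J" and Z: "Z \<in> supp_space (e ` J \<times> J)"
  shows "corrected {1..l} A \<theta> Z \<in> bouligand_tangent (affine_constraints l A b \<inter> RX e U \<sigma> V r) X"
proof (rule bouligand_tangent_lineI)
  fix t :: real
  have "supp_space R_index \<subseteq> supp_space (e ` J \<times> J)"
    using supported_mono[of R_index "e ` J \<times> J"] J(2) unfolding supp_space_def R_index_def by blast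
  then have "X + t *\<^sub>R corrected {1..l} A \<theta> Z \<in> supp_space (e ` J \<times> J)"
    using assms(3) Z X_in_supp_space[OF J(2)]
    by (intro subspace_add subspace_scale corrected_in_subspace subspace_supp_space) auto
  then show "X + t *\<^sub>R corrected {1..l} A \<theta> Z \<in> affine_constraints l A b \<inter> RX e U \<sigma> V r"
    using J corrected_line_in_affine[OF assms(1,2)] unfolding RX_eq by blast
qed

lemma frechet_normal_affine_Int_RX:
  assumes X: "X \<in> affine_constraints l A b" and "assumption2 e U \<sigma> V l A"
  shows "frechet_normal (affine_constraints l A b \<inter> RX e U \<sigma> V r) X
    = frechet_normal (affine_constraints l A b) X + frechet_normal (RX e U \<sigma> V r) X"
proof (rule antisym[OF subsetI frechet_normal_add_subset_Int])
  fix Y assume Y: "Y \<in> frechet_normal (affine_constraints l A b \<inter> RX e U \<sigma> V r) X"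
  obtain \<theta> where \<theta>: "dual_family {1..l} A \<theta>" "\<And>j. \<theta> j \<in> supp_space R_index"
    using assms(2) dual_family_in_supp_space unfolding assumption2_def R_block_eq by blast
  define C where "C = (\<Sum>j\<in>{1..l}. (Y \<bullet> \<theta> j) *\<^sub>R A j)"
  have "Y - C \<in> frechet_normal (RX e U \<sigma> V r) X"
  proof (rule frechet_normal_orthogonalI)
    fix Z assume "Z \<in> RX e U \<sigma> V r"
    then obtain J where J: "card J = r" "\<Gamma> \<subseteq> J" "Z \<in> supp_space (e ` J \<times> J)"
      unfolding RX_eq by blast
    \<comment> \<open>\<open>X\<close> lies in the same subspace as \<open>Z\<close>, whichever
      \<open>J\<close> occurs, so the difference is a two-sided direction there.\<close>
    have mem: "Z - X \<in> supp_space (e ` J \<times> J)" "- (Z - X) \<in> supp_space (e ` J \<times> J)"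
      using J(3) X_in_supp_space[OF J(2)]
      by (auto intro!: subspace_diff subspace_neg subspace_supp_space simp del: minus_diff_eq)
    show "(Y - C) \<bullet> (Z - X) = 0"
      unfolding C_def
      by (rule normal_minus_multipliers_orthogonal[OF Y])
        (rule corrected_tangent_RX[OF X \<theta> J(1,2)], rule mem)+
  qed
  moreover have "C \<in> frechet_normal (affine_constraints l A b) X"
    unfolding C_def by (rule affine_combination_in_frechet_normal[OF X])
  ultimately show "Y \<in> frechet_normal (affine_constraints l A b) X + frechet_normal (RX e U \<sigma> V r) X"
    using set_plus_intro[of C _ "Y - C"] by fastforce
qed

text \<open>A direction with a single entry outside the block \<open>\<Gamma> \<times> \<Gamma>\<close>, corrected inside that block,
  raises the rank by at most one for every step length.\<close>

lemma corrected_tangent_rank_le: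
  assumes "X \<in> affine_constraints l A b" "dual_family {1..l} A \<theta>" "\<And>j. \<theta> j \<in> supp_space R_index"
    and r: "rank X < r"
  shows "corrected {1..l} A \<theta> (unrot (c *\<^sub>R axis i (axis j 1)))
    \<in> bouligand_tangent (affine_constraints l A b \<inter> rank_le r) X" (is "?C \<in> _")
proof (rule bouligand_tangent_lineI)
  fix t :: real
  let ?R = "insert i (e ` \<Gamma>)"
  have sub: "subspace (supp_space (?R \<times> UNIV))"
    by (rule subspace_supp_space)
  have "supp_space (e ` \<Gamma> \<times> \<Gamma>) \<subseteq> supp_space (?R \<times> UNIV)"
    using supported_mono[of "e ` \<Gamma> \<times> \<Gamma>" "?R \<times> UNIV"] unfolding supp_space_def by blast
  moreover have "X \<in> supp_space (e ` \<Gamma> \<times> \<Gamma>)"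
    by (rule X_in_supp_space) simp
  moreover have "unrot (c *\<^sub>R axis i (axis j 1)) \<in> supp_space (?R \<times> UNIV)"
    unfolding supp_space_def
    by (auto intro!: subspace_scale[OF subspace_supported] axis_axis_in_supported)
  ultimately have "X + t *\<^sub>R ?C \<in> supp_space (?R \<times> UNIV)"
    using assms(3) unfolding R_index_def
    by (intro subspace_add[OF sub] subspace_scale[OF sub] corrected_in_subspace[OF sub]) auto
  then have supp: "rot (X + t *\<^sub>R ?C) \<in> supported (?R \<times> UNIV)"
    by (simp add: supp_space_def)
  have "rank (X + t *\<^sub>R ?C) \<le> rank (rot (X + t *\<^sub>R ?C))"
    using rank_unrot_le[of "rot (X + t *\<^sub>R ?C)"] by simp
  also have "\<dots> \<le> card ?R"
    by (rule rank_le_card_nonzero_rows) (auto simp: row_def vec_eq_iff supportedD[OF supp] simp del: One_nat_def)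
  also have "\<dots> \<le> Suc (card \<Gamma>)"
    using card_insert_le_m1[of "Suc (card \<Gamma>)" "e ` \<Gamma>" i] card_image_le[of \<Gamma> e] by simp
  also have "\<dots> \<le> r"
    using card_\<Gamma>_le r by linarith
  finally show "X + t *\<^sub>R ?C \<in> affine_constraints l A b \<inter> rank_le r"
    using corrected_line_in_affine[OF assms(1,2)] by (simp add: rank_le_def)
qed

lemma eq_0_if_rot_entries: "(\<And>i j. rot Y $ i $ j = 0) \<Longrightarrow> Y = 0"
  using inner_rot[of Y Y] by (simp add: inner_vec_def[of "rot Y"] inner_vec_def[of "rot Y $ _"])

text \<open>Testing against all rotated coordinate directions shows that \<open>Y\<close> equals its
  combination of the \<open>A j\<close>.\<close>

lemma frechet_normal_affine_Int_rank_le_subset: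
  assumes X: "X \<in> affine_constraints l A b" and "assumption2 e U \<sigma> V l A" and "rank X < r"
  shows "frechet_normal (affine_constraints l A b \<inter> rank_le r) X
    \<subseteq> frechet_normal (affine_constraints l A b) X"
proof
  fix Y assume Y: "Y \<in> frechet_normal (affine_constraints l A b \<inter> rank_le r) X"
  obtain \<theta> where \<theta>: "dual_family {1..l} A \<theta>" "\<And>j. \<theta> j \<in> supp_space R_index"
    using assms(2) dual_family_in_supp_space unfolding assumption2_def R_block_eq by blast
  let ?C = "\<Sum>j\<in>{1..l}. (Y \<bullet> \<theta> j) *\<^sub>R A j"
  have "rot (Y - ?C) $ i $ j = 0" for i j
  proof -
    have neg: "- unrot (axis i (axis j 1)) = unrot ((- 1) *\<^sub>R axis i (axis j 1))"
      using linear_cmul[OF linear_unrot, of "- 1"] by simp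
    have "(Y - ?C) \<bullet> unrot (axis i (axis j 1)) = 0"
    proof (rule normal_minus_multipliers_orthogonal[OF Y])
      show "corrected {1..l} A \<theta> (unrot (axis i (axis j 1)))
          \<in> bouligand_tangent (affine_constraints l A b \<inter> rank_le r) X"
        using corrected_tangent_rank_le[OF X \<theta> assms(3), of 1 i j] by simp
      show "corrected {1..l} A \<theta> (- unrot (axis i (axis j 1)))
          \<in> bouligand_tangent (affine_constraints l A b \<inter> rank_le r) X"
        unfolding neg by (rule corrected_tangent_rank_le[OF X \<theta> assms(3)])
    qed
    then show ?thesis
      by (simp only: inner_unrot inner_axis_axis_matrix)
  qed
  then have "Y - ?C = 0"
    by (rule eq_0_if_rot_entries)
  then show "Y \<in> frechet_normal (affine_constraints l A b) X"
    using affine_combination_in_frechet_normal[OF X, of "\<lambda>j. Y \<bullet> \<theta> j"] by simp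
qed

text \<open>In the square case \<open>e\<close> is bijective, so every position is some
  \<open>(e p, j)\<close>. The two spare indices allow an admissible \<open>J\<close> containing
  both \<open>p\<close> and \<open>j\<close>, which makes every coordinate direction
  tangent.\<close>

lemma frechet_normal_RX_trivial:
  assumes "CARD('m) = CARD('n)" "rank X + 2 \<le> r" "r < CARD('n)"
  shows "frechet_normal (RX e U \<sigma> V r) X = {0}"
proof (intro equalityI subsetI)
  fix Y assume Y: "Y \<in> frechet_normal (RX e U \<sigma> V r) X"
  have surj: "range e = UNIV"
    using assms(1) inj_e by (intro card_subset_eq) (auto simp: card_image)
  have "rot Y $ i $ j = 0" for i j
  proof -
    obtain p where p: "i = e p"
      using surj by blast
    have "card (\<Gamma> \<union> {p, j}) \<le> r"
      using card_Un_le[of \<Gamma> "{p, j}"] card_insert_le_m1[of 2 "{j}" p] card_\<Gamma>_le assms(2) by simp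
    then obtain J where J: "\<Gamma> \<union> {p, j} \<subseteq> J" "card J = r"
      using exists_subset_between[of "\<Gamma> \<union> {p, j}" r UNIV] assms(3) by auto
    have tangent: "unrot (c *\<^sub>R axis i (axis j 1)) \<in> bouligand_tangent (RX e U \<sigma> V r) X" for c
    proof (rule bouligand_tangent_lineI)
      fix t :: real
      have "unrot (c *\<^sub>R axis i (axis j 1)) \<in> supp_space (e ` J \<times> J)"
        using J(1) p unfolding supp_space_def
        by (auto intro!: subspace_scale[OF subspace_supported] axis_axis_in_supported)
      then have "X + t *\<^sub>R unrot (c *\<^sub>R axis i (axis j 1)) \<in> supp_space (e ` J \<times> J)"
        using J(1) by (intro subspace_add subspace_scale subspace_supp_space X_in_supp_space) auto
      then show "X + t *\<^sub>R unrot (c *\<^sub>R axis i (axis j 1)) \<in> RX e U \<sigma> V r"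
        using J unfolding RX_eq by blast
    qed
    have "c * rot Y $ i $ j \<le> 0" for c
      using frechet_normalD[OF Y tangent[of c]] by (simp add: inner_unrot inner_axis_axis_matrix)
    from this[of 1] this[of "- 1"] show ?thesis
      by simp
  qed
  then show "Y \<in> {0}"
    using eq_0_if_rot_entries by blast
qed (simp add: zero_in_frechet_normal)

section \<open>Rank equal to \<open>r\<close>: tangent vectors and second-order curves\<close>

text \<open>An entry of \<open>rot \<Xi>\<close> outside \<open>T_index\<close> pairs
  \<open>\<Xi>\<close> with a column of \<open>U\<close> and a column of \<open>V\<close> that are
  null vectors of \<open>transpose X\<close> and \<open>X\<close>.\<close>

lemma tangent_rank_le_subset:
  "bouligand_tangent (rank_le (rank X)) X \<subseteq> supp_space T_index"
proof
  fix \<Xi> assume \<Xi>: "\<Xi> \<in> bouligand_tangent (rank_le (rank X)) X"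
  have "rot \<Xi> $ i $ j = 0" if "(i, j) \<notin> T_index" for i j
  proof -
    let ?u = "U *v axis i 1" and ?v = "V *v axis j 1"
    have ij: "i \<notin> e ` \<Gamma>" "j \<notin> \<Gamma>"
      using that unfolding T_index_def by auto
    have "X *v ?v = U *v ((D ** (transpose V ** V)) *v axis j 1)"
      unfolding X_eq unrot_def by (simp only: matrix_vector_mul_assoc matrix_mul_assoc)
    also have "D ** (transpose V ** V) = D"
      by (simp add: orthogonal_factors)
    also have "D *v axis j 1 = 0"
      using ij by (simp add: matrix_vector_mult_basis column_def rect_diag_def vec_eq_iff sv_support_def)
    finally have v: "X *v ?v = 0"
      by simp
    have "transpose X *v ?u = V *v ((transpose D ** (transpose U ** U)) *v axis i 1)"
      unfolding X_eq unrot_def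
      by (simp only: matrix_vector_mul_assoc matrix_mul_assoc matrix_transpose_mul transpose_transpose)
    also have "transpose D ** (transpose U ** U) = transpose D"
      by (simp add: orthogonal_factors)
    also have "transpose D *v axis i 1 = 0"
      using ij by (auto simp: matrix_vector_mult_basis column_def transpose_def rect_diag_def
          vec_eq_iff sv_support_def)
    finally have u: "transpose X *v ?u = 0"
      by simp
    have "rot \<Xi> $ i $ j = axis i 1 \<bullet> (rot \<Xi> *v axis j 1)"
      by (simp add: inner_axis' matrix_vector_mult_basis column_def)
    also have "\<dots> = axis i 1 \<bullet> (transpose U *v (\<Xi> *v ?v))"
      unfolding rot_def by (simp only: matrix_vector_mul_assoc matrix_mul_assoc)
    also have "\<dots> = ?u \<bullet> (\<Xi> *v ?v)"
      by (metis dot_lmul_matrix vector_transpose_matrix)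
    also have "\<dots> = 0"
      by (rule tangent_rank_le_kernel[OF \<Xi> v u])
    finally show ?thesis .
  qed
  then show "\<Xi> \<in> supp_space T_index"
    by (simp add: supp_space_def supported_def)
qed

text \<open>The Moore-Penrose inverse of \<open>D\<close>; the convention
  \<open>inverse 0 = 0\<close> treats the vanishing singular values.\<close>

definition pinv :: "real^'m^'n" where
  "pinv = (\<chi> j i. if i = e j then inverse (\<sigma> $ j) else 0)"

lemma pinv_D: "pinv ** D = (\<chi> i j. if i = j \<and> j \<in> \<Gamma> then 1 else 0)"
proof -
  have "(\<Sum>k\<in>UNIV. (if k = e i then inverse (\<sigma> $ i) else 0) * (if k = e j then \<sigma> $ j else 0))
      = (\<Sum>k\<in>UNIV. if k = e i then inverse (\<sigma> $ i) * (if k = e j then \<sigma> $ j else 0) else 0)" for i j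
    by (rule sum.cong) auto
  then have "(\<Sum>k\<in>UNIV. (if k = e i then inverse (\<sigma> $ i) else 0) * (if k = e j then \<sigma> $ j else 0))
      = (if i = j \<and> j \<in> \<Gamma> then 1 else 0)" for i j
    using inj_e by (simp add: inj_eq sv_support_def)
  then show ?thesis
    by (simp add: vec_eq_iff pinv_def matrix_matrix_mult_def rect_diag_def)
qed

lemma D_pinv: "D ** pinv = (\<chi> i j. if i = j \<and> i \<in> e ` \<Gamma> then 1 else 0)"
proof -
  have "(\<Sum>k\<in>UNIV. (if i = e k then \<sigma> $ k else 0) * (if j = e k then inverse (\<sigma> $ k) else 0))
      = (if i = j \<and> i \<in> e ` \<Gamma> then 1 else 0)" for i j
  proof (cases "i = j \<and> i \<in> e ` \<Gamma>")
    case True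
    then obtain p where p: "i = e p" "j = e p" "p \<in> \<Gamma>"
      by blast
    have "(\<Sum>k\<in>UNIV. (if i = e k then \<sigma> $ k else 0) * (if j = e k then inverse (\<sigma> $ k) else 0))
        = (\<Sum>k\<in>UNIV. if k = p then 1 else 0)"
      using inj_e p by (intro sum.cong) (auto simp: inj_eq sv_support_def)
    then show ?thesis
      unfolding if_P[OF True] by simp
  next
    case False
    then show ?thesis
      by (auto simp: sv_support_def intro!: sum.neutral)
  qed
  then show ?thesis
    by (simp add: vec_eq_iff pinv_def matrix_matrix_mult_def rect_diag_def)
qed

lemma mult_pinv_D: "(P ** (pinv ** D)) $ i $ j = (if j \<in> \<Gamma> then P $ i $ j else 0)"
proof -
  have "(P ** (pinv ** D)) $ i $ j = (\<Sum>k\<in>UNIV. if k = j then (if j \<in> \<Gamma> then P $ i $ j else 0) else 0)"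
    unfolding pinv_D unfolding matrix_matrix_mult_def vec_lambda_beta by (rule sum.cong) auto
  then show ?thesis
    by simp
qed

lemma D_pinv_mult: "((D ** pinv) ** P) $ i $ j = (if i \<in> e ` \<Gamma> then P $ i $ j else 0)"
proof -
  have "((D ** pinv) ** P) $ i $ j
      = (\<Sum>k\<in>UNIV. if k = i then (if i \<in> e ` \<Gamma> then P $ i $ j else 0) else 0)"
    unfolding D_pinv unfolding matrix_matrix_mult_def vec_lambda_beta by (rule sum.cong) auto
  then show ?thesis
    by simp
qed

lemma T_index_decompose:
  assumes "P \<in> supported T_index"
  shows "P ** (pinv ** D) + (D ** pinv) ** P ** (mat 1 - pinv ** D) = P"
  using supportedD[OF assms]
  by (auto simp: vec_eq_iff matrix_mult_bilinear_simps mult_pinv_D D_pinv_mult T_index_def)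

text \<open>For equal arguments this is the cross term of the product of two perturbed factors
  around \<open>D\<close>. As a bilinear map it gets continuity and a quadratic bound from
  boundedness.\<close>

definition second_order :: "real^'n^'m \<Rightarrow> real^'n^'m \<Rightarrow> real^'n^'m" where
  "second_order Y Z = unrot (rot Y ** (pinv ** D ** pinv) ** rot Z ** (mat 1 - pinv ** D))"

lemma bounded_bilinear_second_order: "bounded_bilinear second_order"
  unfolding bilinear_conv_bounded_bilinear[symmetric] bilinear_def second_order_def
  by (auto intro!: linearI simp: linear_add[OF linear_rot] linear_add[OF linear_unrot]
      linear_cmul[OF linear_rot] linear_cmul[OF linear_unrot] linear_diff[OF linear_unrot]
      scaleR_diff_right matrix_mult_bilinear_simps)

text \<open>With \<open>P\<close> the rotated \<open>Y\<close> and \<open>Q = I - D\<^sup>+ D\<close>, the matrix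
  \<open>(I + P D\<^sup>+) D (I + D\<^sup>+ P Q)\<close> equals \<open>D + P\<close> up to a quadratic term.\<close>

lemma rank_second_order_curve:
  assumes "Y \<in> supp_space T_index"
  shows "rank (X + Y + second_order Y Y) \<le> rank X"
proof -
  define P where "P = rot Y"
  define Q where "Q = mat 1 - pinv ** D"
  have P: "P \<in> supported T_index"
    using assms unfolding P_def supp_space_def by simp
  have "(mat 1 + P ** pinv) ** D ** (mat 1 + pinv ** P ** Q)
      = D + (P ** (pinv ** D) + (D ** pinv) ** P ** Q) + P ** (pinv ** D ** pinv) ** P ** Q"
    by (simp add: matrix_mult_bilinear_simps matrix_mul_assoc)
  also have "\<dots> = D + P + P ** (pinv ** D ** pinv) ** P ** Q"
    unfolding Q_def T_index_decompose[OF P] ..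
  finally have "X + Y + second_order Y Y = unrot ((mat 1 + P ** pinv) ** D ** (mat 1 + pinv ** P ** Q))"
    by (simp add: second_order_def P_def Q_def linear_add[OF linear_unrot] X_eq[symmetric])
  then have "rank (X + Y + second_order Y Y) \<le> rank ((mat 1 + P ** pinv) ** D ** (mat 1 + pinv ** P ** Q))"
    using rank_unrot_le by simp
  also have "\<dots> \<le> rank D"
    by (meson order_trans rank_mul_le_left rank_mul_le_right)
  also have "\<dots> \<le> rank X"
    by (rule rank_D_le)
  finally show ?thesis .
qed

text \<open>The fixed point argument applies with \<open>T\<close> the space of all matrices
  supported, after rotation, on \<open>T_index\<close>; it contains \<open>\<Xi>\<close> and the
  dual directions.\<close>

lemma tangent_affine_Int_rank_le:
  assumes X: "X \<in> affine_constraints l A b"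
    and \<theta>: "dual_family {1..l} A \<theta>" "\<And>j. \<theta> j \<in> supp_space T_index"
    and \<Xi>: "\<Xi> \<in> supp_space T_index" "\<And>i. i \<in> {1..l} \<Longrightarrow> A i \<bullet> \<Xi> = 0"
  shows "\<Xi> \<in> bouligand_tangent (affine_constraints l A b \<inter> rank_le (rank X)) X"
proof -
  obtain K where K: "\<And>Y Z. norm (second_order Y Z) \<le> norm Y * norm Z * K"
    using bounded_bilinear.bounded[OF bounded_bilinear_second_order] by blast
  show ?thesis
  proof (rule bouligand_tangent_affine_Int[OF X \<theta>(1) subspace_supp_space \<Xi>(1) \<theta>(2)])
    show "continuous_on UNIV (\<lambda>w. second_order w w)"
      by (intro bounded_bilinear.continuous_on[OF bounded_bilinear_second_order] continuous_on_id)
    show "norm (second_order w w) \<le> K * (norm w)\<^sup>2" for w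
      using K[of w w] by (simp add: power2_eq_square mult_ac)
    show "X + w + second_order w w \<in> rank_le (rank X)" if "w \<in> supp_space T_index" for w
      using rank_second_order_curve[OF that] by (simp add: rank_le_def)
  qed (rule \<Xi>(2))
qed

lemma frechet_normal_affine_Int_rank_le:
  assumes X: "X \<in> affine_constraints l A b" and "assumption1 e U \<sigma> V l A"
  shows "frechet_normal (affine_constraints l A b \<inter> rank_le (rank X)) X
    = frechet_normal (affine_constraints l A b) X + frechet_normal (rank_le (rank X)) X"
proof (rule antisym[OF subsetI frechet_normal_add_subset_Int])
  fix Y assume Y: "Y \<in> frechet_normal (affine_constraints l A b \<inter> rank_le (rank X)) X"
  obtain \<theta> where \<theta>: "dual_family {1..l} A \<theta>" "\<And>j. \<theta> j \<in> supp_space T_index"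
    using assms(2) dual_family_in_supp_space unfolding assumption1_def T_block_eq by blast
  define C where "C = (\<Sum>j\<in>{1..l}. (Y \<bullet> \<theta> j) *\<^sub>R A j)"
  have tangent: "corrected {1..l} A \<theta> Z
      \<in> bouligand_tangent (affine_constraints l A b \<inter> rank_le (rank X)) X"
    if "Z \<in> supp_space T_index" for Z
    by (rule tangent_affine_Int_rank_le[OF X \<theta>
          corrected_in_subspace[OF subspace_supp_space that \<theta>(2)] inner_corrected[OF \<theta>(1)]]) auto
  have "(Y - C) \<bullet> Z = 0" if "Z \<in> supp_space T_index" for Z
    unfolding C_def
    by (rule normal_minus_multipliers_orthogonal[OF Y tangent[OF that]
          tangent[OF subspace_neg[OF subspace_supp_space that]]])
  \<comment> \<open>All tangent vectors of the rank constraint lie in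
    \<open>supp_space T_index\<close>, to which \<open>Y - C\<close> is orthogonal.\<close>
  then have "Y - C \<in> frechet_normal (rank_le (rank X)) X"
    using tangent_rank_le_subset unfolding frechet_normal_def polar_def by fastforce
  moreover have "C \<in> frechet_normal (affine_constraints l A b) X"
    unfolding C_def by (rule affine_combination_in_frechet_normal[OF X])
  ultimately show "Y \<in> frechet_normal (affine_constraints l A b) X + frechet_normal (rank_le (rank X)) X"
    using set_plus_intro[of C _ "Y - C"] by fastforce
qed

end

theorem theorem2p1:
  fixes X :: "real^'n^'m" and U :: "real^'m^'m" and V :: "real^'n^'n" and \<sigma> :: "real^'n"
    and e :: "'n \<Rightarrow> 'm" and l r s :: nat
    and A :: "nat \<Rightarrow> real^'n^'m" and b :: "nat \<Rightarrow> real"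
  defines "L \<equiv> affine_constraints l A b"
    and "Rr \<equiv> (rank_le r :: (real^'n^'m) set)"
    and "RXr \<equiv> RX e U \<sigma> V r"
  assumes "CARD('n) \<le> CARD('m)" and "inj e"
    and "1 \<le> r" and "r < CARD('n)"
    and "X \<in> L \<inter> Rr" and "rank X = s"
    and "is_svd e X U \<sigma> V"
  shows
    "(s = r \<and> assumption1 e U \<sigma> V l A \<longrightarrow>
        frechet_normal (L \<inter> Rr) X = frechet_normal L X + frechet_normal Rr X)
     \<and>
     (s < r \<and> assumption2 e U \<sigma> V l A \<longrightarrow>
        frechet_normal (L \<inter> Rr) X \<subseteq> frechet_normal (L \<inter> RXr) X \<and>
        frechet_normal (L \<inter> RXr) X = frechet_normal L X + frechet_normal RXr X \<and>
        (frechet_normal RXr X \<subseteq> bouligand_tangent L X \<longrightarrow>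
           frechet_normal (L \<inter> Rr) X = frechet_normal L X + frechet_normal Rr X \<and>
           frechet_normal L X + frechet_normal Rr X = frechet_normal L X) \<and>
        (s + 2 \<le> r \<and> CARD('m) = CARD('n) \<longrightarrow>
           frechet_normal RXr X \<subseteq> bouligand_tangent L X))"
proof -
  interpret svd e X U \<sigma> V
    using assms by unfold_locales
  have X: "X \<in> affine_constraints l A b"
    using assms by auto
  have i: "frechet_normal (L \<inter> Rr) X = frechet_normal L X + frechet_normal Rr X"
    if "s = r" "assumption1 e U \<sigma> V l A"
    using frechet_normal_affine_Int_rank_le[OF X that(2)] that(1) assms by simp
  have inclusion: "frechet_normal (L \<inter> Rr) X \<subseteq> frechet_normal (L \<inter> RXr) X"
    unfolding L_def Rr_def RXr_def using RX_subset_rank_le[of r] by (intro frechet_normal_antimono) blast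
  have equality: "frechet_normal (L \<inter> RXr) X = frechet_normal L X + frechet_normal RXr X"
    if "assumption2 e U \<sigma> V l A"
    unfolding L_def RXr_def by (rule frechet_normal_affine_Int_RX[OF X that])
  have collapse: "frechet_normal (L \<inter> Rr) X = frechet_normal L X + frechet_normal Rr X \<and>
      frechet_normal L X + frechet_normal Rr X = frechet_normal L X"
    if "s < r" "assumption2 e U \<sigma> V l A"
  proof -
    \<comment> \<open>This closes a cycle of inclusions: the normal cone of \<open>L\<close> lies in
      the sum, and the sum in the normal cone of the intersection.\<close>
    have "frechet_normal (L \<inter> Rr) X \<subseteq> frechet_normal L X"
      unfolding L_def Rr_def
      using that assms(9) by (intro frechet_normal_affine_Int_rank_le_subset[OF X]) auto
    then show ?thesis
      using frechet_normal_add_subset_Int[of L X Rr] frechet_normal_add_superset[of L X Rr] by blast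
  qed
  \<comment> \<open>Zero is the only vector to check, because the normal cone of \<open>RXr\<close>
    is trivial here.\<close>
  have "0 \<in> bouligand_tangent L X"
    using X unfolding L_def by (intro bouligand_tangent_lineI) simp
  then have trivial: "frechet_normal RXr X \<subseteq> bouligand_tangent L X"
    if "s + 2 \<le> r" "CARD('m) = CARD('n)"
    using frechet_normal_RX_trivial[of r] that assms by simp
  show ?thesis
    using i inclusion equality collapse trivial by blast
qed

end
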